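(* Let $n$ and $k$ be integers with $1\le k\le n-1$. Then there exist an integer $q\ge 2$ and a random vector $X=(X_1,\dots,X_n)$, each of whose components $X_i$ takes values in a finite set of cardinality $q$, such that, with entropies computed with logarithms to base $q$, $$\mathcal{C}^{(k)}(X)=k\binom{n-1}{k}.$$
   Context: Let $X=(X_1,\dots,X_n)$ be a vector of $n$ jointly distributed random variables, each $X_i$ taking values in a finite set of the same cardinality $q\ge 2$ ("marginal support $q$"). Shannon entropy is taken with logarithms to base $q$: $H(Y)=\sum_y p(y)\log_q(1/p(y))$. For $A\subseteq\{1,\dots,n\}$ write $X_A=(X_i)_{i\in A}$. For $1\le k\le n-1$, the Cohesion-$k$ measure is $$\mathcal{C}^{(k)}(X)=\sum_{A\subseteq\{1,\dots,n\},\,|A|=k}H(X_A)-\binom{n-1}{k-1}H(X).$$ The value $k\binom{n-1}{k}$ is the constant upper bound for $\mathcal{C}^{(k)}$. *)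

theory Defs
  imports "HOL-Probability.Probability"
begin

context prob_space
begin

definition joint_entropy :: "real \<Rightarrow> (nat \<Rightarrow> 'a \<Rightarrow> 'b) \<Rightarrow> nat set \<Rightarrow> real" where
  "joint_entropy b X A =
    (let XA = (\<lambda>\<omega>. \<lambda>i\<in>A. X i \<omega>) in entropy b (count_space (XA ` space M)) XA)"

definition cohesion :: "real \<Rightarrow> nat \<Rightarrow> nat \<Rightarrow> (nat \<Rightarrow> 'a \<Rightarrow> 'b) \<Rightarrow> real" where
  "cohesion b n k X =
    (\<Sum>A | A \<subseteq> {1..n} \<and> card A = k. joint_entropy b X A)
      - real ((n - 1) choose (k - 1)) * joint_entropy b X {1..n}"

text \<open>The random variable with index \<open>i \<in> {1..n}\<close> takes values in its own alphabet
  \<open>S i\<close>; all these alphabets have \<open>q\<close> elements. Values of \<open>X\<close> and \<open>S\<close>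
  at indices outside \<open>{1..n}\<close> are irrelevant.\<close>

definition random_vector :: "nat \<Rightarrow> nat \<Rightarrow> (nat \<Rightarrow> 'b set) \<Rightarrow> (nat \<Rightarrow> 'a \<Rightarrow> 'b) \<Rightarrow> bool" where
  "random_vector n q S X \<longleftrightarrow>
    (\<forall>i\<in>{1..n}. finite (S i) \<and> card (S i) = q \<and> random_variable (count_space (S i)) (X i))"

end

text \<open>For finite alphabets, \<open>joint_entropy\<close> is the usual finite sum over the joint outcomes.
  Outcomes of probability zero contribute nothing, as \<open>0 * log b (1 / 0) = 0\<close>.\<close>

lemma (in information_space) joint_entropy_eq_sum:
  assumes X: "random_vector n q S X" and A: "A \<subseteq> {1..n}"
  shows "joint_entropy b X A =
    (\<Sum>y\<in>Pi\<^sub>E A S. prob {\<omega> \<in> space M. \<forall>i\<in>A. X i \<omega> = y i} *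
      log b (1 / prob {\<omega> \<in> space M. \<forall>i\<in>A. X i \<omega> = y i}))"
proof -
  define XA where "XA = (\<lambda>\<omega>. \<lambda>i\<in>A. X i \<omega>)"
  define P where "P = (\<lambda>y. prob {\<omega> \<in> space M. \<forall>i\<in>A. X i \<omega> = y i})"
  have finA: "finite A" using A finite_subset by blast
  have meas: "X i \<in> measurable M (count_space (S i))" "finite (S i)" if "i \<in> A" for i
    using X A that unfolding random_vector_def by auto
  have fin: "finite (Pi\<^sub>E A S)" using finA meas by (intro finite_PiE) auto
  have im: "XA ` space M \<subseteq> Pi\<^sub>E A S"
    using meas(1) by (fastforce simp: XA_def dest: measurable_space)
  have eq: "XA -` {y} \<inter> space M = {\<omega> \<in> space M. \<forall>i\<in>A. X i \<omega> = y i}" if "y \<in> Pi\<^sub>E A S" for y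
  proof -
    have "XA \<omega> = y \<longleftrightarrow> (\<forall>i\<in>A. X i \<omega> = y i)" for \<omega>
      using that by (auto simp: XA_def fun_eq_iff PiE_def extensional_def restrict_def)
    then show ?thesis by auto
  qed
  have single: "{\<omega> \<in> space M. X i \<omega> = y i} \<in> events" if "i \<in> A" "y \<in> Pi\<^sub>E A S" for i y
  proof -
    have "{y i} \<in> sets (count_space (S i))" using that by auto
    from measurable_sets[OF meas(1)[OF that(1)] this] show ?thesis
      by (simp add: vimage_def Int_def conj_commute)
  qed
  have sets: "XA -` {y} \<inter> space M \<in> events" if "y \<in> Pi\<^sub>E A S" for y
    unfolding eq[OF that] by (rule sets.sets_Collect_finite_All[OF single finA]) (use that in auto)
  have sf: "simple_function M XA"
    unfolding simple_function_def using finite_subset[OF im fin] sets im by auto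
  have "simple_distributed M XA P"
  proof (rule simple_distributedI[OF sf])
    fix y assume "y \<in> XA ` space M"
    then have "y \<in> Pi\<^sub>E A S" using im by blast
    then show "P y = measure M (XA -` {y} \<inter> space M)" by (simp add: P_def eq)
  qed (simp add: P_def)
  then have "joint_entropy b X A = - (\<Sum>y\<in>XA ` space M. P y * log b (P y))"
    unfolding joint_entropy_def Let_def XA_def[symmetric] by (rule entropy_simple_distributed)
  also have "\<dots> = - (\<Sum>y\<in>Pi\<^sub>E A S. P y * log b (P y))"
  proof -
    have "P y = 0" if "y \<in> Pi\<^sub>E A S" "y \<notin> XA ` space M" for y
    proof -
      have "XA -` {y} \<inter> space M = {}" using that(2) by auto
      then show ?thesis unfolding P_def eq[OF that(1), symmetric] by simp
    qed
    then show ?thesis using fin im by (subst sum.mono_neutral_left[of "Pi\<^sub>E A S"]) auto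
  qed
  also have "\<dots> = (\<Sum>y\<in>Pi\<^sub>E A S. P y * log b (1 / P y))"
    unfolding sum_negf[symmetric]
  proof (rule sum.cong[OF refl])
    fix y show "- (P y * log b (P y)) = P y * log b (1 / P y)"
      by (cases "P y = 0") (simp_all add: log_divide P_def less_le b_gt_1)
  qed
  finally show ?thesis unfolding P_def .
qed

end

theory Submission
  imports Defs "HOL-Computational_Algebra.Polynomial" "HOL-Computational_Algebra.Primes"
begin

text \<open>A uniformly random Reed--Solomon codeword attains the bound. Let \<open>q > n\<close> be prime and let
  \<open>X\<^sub>i\<close> be the value at \<open>i\<close> of a uniformly random polynomial of degree less than \<open>k\<close> over the field
  with \<open>q\<close> elements. Such a polynomial is determined by its values at any \<open>k\<close> points, so every
  \<open>X\<^sub>A\<close> with \<open>|A| \<ge> k\<close> is an injective function of the \<open>q\<^sup>k\<close> polynomials and has entropy \<open>k\<close>.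
  Hence the cohesion is \<open>k\<close> times the difference of \<open>n choose k\<close> and \<open>(n - 1) choose (k - 1)\<close>.\<close>

text \<open>Lagrange's bound on the number of roots modulo a prime, phrased with integer
  polynomials. Splitting off one point \<open>a\<close> by synthetic division leaves a quotient of
  smaller degree; it vanishes modulo \<open>p\<close> at the other points because \<open>p\<close>
  is prime and does not divide \<open>x - a\<close>.\<close>

lemma prime_dvd_poly_if_dvd_values:
  fixes p :: int and P :: "int poly"
  assumes "prime p" and "finite A"
    and "\<And>x y. x \<in> A \<Longrightarrow> y \<in> A \<Longrightarrow> p dvd x - y \<Longrightarrow> x = y"
    and "\<And>x. x \<in> A \<Longrightarrow> p dvd poly P x"
    and "degree P < card A"
  shows "[:p:] dvd P"
  using assms(2-5)
proof (induction A arbitrary: P rule: finite_induct)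
  case empty
  then show ?case by simp
next
  case (insert a B)
  define R where "R = synthetic_div P a"
  have P: "P = [:-a, 1:] * R + [:poly P a:]"
    unfolding R_def by (rule synthetic_div_correct'[symmetric])
  have "[:p:] dvd R"
  \<comment> \<open>For empty \<open>B\<close> the bound \<open>degree R < card B\<close> fails even
    for \<open>R = 0\<close>, so this case is settled directly: \<open>P\<close> is constant and its
    quotient vanishes.\<close>
  proof (cases "B = {}")
    case True
    then have "degree P = 0" using insert.prems(3) by simp
    then have "R = 0" unfolding R_def by (simp only: synthetic_div_eq_0_iff)
    then show ?thesis by simp
  next
    case False
    show ?thesis
    proof (rule insert.IH)
      fix x assume x: "x \<in> B"
      have "(x - a) * poly R x = poly P x - poly P a"
        using arg_cong[OF P, of "\<lambda>Q. poly Q x"] by (simp add: algebra_simps)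
      then have "p dvd (x - a) * poly R x"
        using x insert.prems(2) by (simp add: dvd_diff)
      moreover have "\<not> p dvd x - a"
        using x insert.prems(1)[of x a] insert.hyps(2) by auto
      ultimately show "p dvd poly R x"
        using \<open>prime p\<close> by (simp add: prime_dvd_mult_iff)
    next
      have "card B > 0" using False insert.hyps(1) by (simp add: card_gt_0_iff)
      then show "degree R < card B"
        using insert.prems(3) insert.hyps by (simp add: R_def degree_synthetic_div)
    qed (use insert.prems(1) in auto)
  qed
  moreover have "[:p:] dvd [:poly P a:]"
    using insert.prems(2) by simp
  ultimately show ?case
    by (subst P) (intro dvd_add dvd_mult)
qed

text \<open>Messages are coefficient vectors. Representing residues by naturals below
  \<open>q\<close> lets \<open>q\<close> be chosen inside a proof, which a type of field elements
  would not allow.\<close>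

definition rs_messages :: "nat \<Rightarrow> nat \<Rightarrow> (nat \<Rightarrow> nat) set" where
  "rs_messages q k = {..<k} \<rightarrow>\<^sub>E {..<q}"

definition rs_symbol :: "nat \<Rightarrow> nat \<Rightarrow> nat \<Rightarrow> (nat \<Rightarrow> nat) \<Rightarrow> nat" where
  "rs_symbol q k i c = (\<Sum>j<k. c j * i ^ j) mod q"

lemma finite_rs_messages: "finite (rs_messages q k)"
  by (simp add: rs_messages_def finite_PiE)

lemma card_rs_messages: "card (rs_messages q k) = q ^ k"
  by (simp add: rs_messages_def card_PiE)

text \<open>The difference of two messages that agree on \<open>A\<close> has degree below
  \<open>k\<close> and vanishes modulo \<open>q\<close> on \<open>A\<close>, whose points are
  distinct modulo \<open>q\<close> because \<open>n < q\<close>. Hence \<open>q\<close> divides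
  every coefficient difference, and these are smaller than \<open>q\<close> in absolute
  value.\<close>

lemma inj_on_rs_symbols:
  assumes "prime q" and "n < q" and "A \<subseteq> {1..n}" and "k \<le> card A"
  shows "inj_on (\<lambda>c. \<lambda>i\<in>A. rs_symbol q k i c) (rs_messages q k)"
proof (rule inj_onI)
  fix c d
  assume c: "c \<in> rs_messages q k" and d: "d \<in> rs_messages q k"
    and eq: "(\<lambda>i\<in>A. rs_symbol q k i c) = (\<lambda>i\<in>A. rs_symbol q k i d)"
  define P where "P = (\<Sum>j<k. monom (int (c j) - int (d j)) j)"
  have finA: "finite A" using assms(3) finite_subset by blast
  have coeff: "coeff P j = int (c j) - int (d j)" if "j < k" for j
    using that by (simp add: P_def coeff_sum if_distrib cong: if_cong)
  have "c j = d j" if j: "j < k" for j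
  proof -
    have "[:int q:] dvd P"
    proof (rule prime_dvd_poly_if_dvd_values)
      show "prime (int q)" using assms(1) by simp
      show "finite (int ` A)" using finA by simp
      show "x = y" if "x \<in> int ` A" "y \<in> int ` A" "int q dvd x - y" for x y
      proof -
        have "x < int q" "y < int q" "0 \<le> x" "0 \<le> y" using that assms(2,3) by auto
        then show ?thesis using that(3) by (metis mod_eq_dvd_iff mod_pos_pos_trivial)
      qed
      show "int q dvd poly P x" if "x \<in> int ` A" for x
      proof -
        obtain i where i: "i \<in> A" "x = int i" using \<open>x \<in> int ` A\<close> by blast
        have "rs_symbol q k i c = rs_symbol q k i d"
          using fun_cong[OF eq, of i] i(1) by simp
        then have "int (\<Sum>j<k. c j * i ^ j) mod int q = int (\<Sum>j<k. d j * i ^ j) mod int q"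
          by (simp only: rs_symbol_def flip: zmod_int)
        then have "int q dvd int (\<Sum>j<k. c j * i ^ j) - int (\<Sum>j<k. d j * i ^ j)"
          by (simp only: mod_eq_dvd_iff)
        also have "\<dots> = poly P x"
          by (simp add: P_def i(2) poly_sum poly_monom sum_subtractf left_diff_distrib)
        finally show ?thesis .
      qed
      \<comment> \<open>The strict bound below comes from \<open>j < k\<close>, which makes
        \<open>k\<close> positive and so \<open>k - 1 < k\<close>.\<close>
      have "degree P \<le> k - 1"
        unfolding P_def by (intro degree_sum_le) (auto intro: order.trans[OF degree_monom_le])
      then show "degree P < card (int ` A)"
        using j assms(4) by (simp add: card_image)
    qed
    then have "int q dvd int (c j) - int (d j)"
      using coeff[OF j] by (metis const_poly_dvd_iff)
    moreover have "c j < q" "d j < q"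
      using c d j by (auto simp: rs_messages_def)
    ultimately show ?thesis
      by (metis mod_eq_dvd_iff mod_pos_pos_trivial of_nat_0_le_iff of_nat_less_iff of_nat_eq_iff)
  qed
  with c d show "c = d"
    unfolding rs_messages_def by (intro PiE_ext) auto
qed

text \<open>Injectivity makes all fibres singletons, so the joint variable is uniform on an image of
  size \<open>card \<Omega>\<close>.\<close>

lemma joint_entropy_uniform_inj:
  fixes b :: real
  assumes "finite \<Omega>" and "\<Omega> \<noteq> {}" and "1 < b"
    and inj: "inj_on (\<lambda>\<omega>. \<lambda>i\<in>A. X i \<omega>) \<Omega>"
  shows "prob_space.joint_entropy (uniform_count_measure \<Omega>) b X A = log b (card \<Omega>)"
proof -
  let ?M = "uniform_count_measure \<Omega>"
  let ?Y = "\<lambda>\<omega>. \<lambda>i\<in>A. X i \<omega>"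
  interpret prob_space ?M
    using assms by (intro prob_space_uniform_count_measure)
  interpret information_space ?M b
    using assms(3) by unfold_locales
  have space: "space ?M = \<Omega>" by (simp add: space_uniform_count_measure)
  have sf: "simple_function ?M ?Y"
    unfolding simple_function_def space
    using assms(1) by (auto simp: sets_uniform_count_measure)
  have sd: "simple_distributed ?M ?Y (\<lambda>_. 1 / card \<Omega>)"
  proof (rule simple_distributedI[OF sf])
    fix y assume "y \<in> ?Y ` space ?M"
    then obtain \<omega> where \<omega>: "\<omega> \<in> \<Omega>" "y = ?Y \<omega>" by (auto simp: space)
    then have "?Y -` {y} \<inter> space ?M = {\<omega>}"
      using inj by (auto simp: space dest: inj_onD)
    then show "1 / card \<Omega> = measure ?M (?Y -` {y} \<inter> space ?M)"
      using \<omega>(1) assms(1) by (simp add: measure_uniform_count_measure)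
  qed simp
  have "joint_entropy b X A = - (\<Sum>y\<in>?Y ` \<Omega>. 1 / card \<Omega> * log b (1 / card \<Omega>))"
    unfolding joint_entropy_def Let_def using entropy_simple_distributed[OF sd]
    by (simp add: space)
  also have "\<dots> = log b (card \<Omega>)"
    using assms by (simp add: card_image[OF inj] log_divide)
  finally show ?thesis .
qed

text \<open>Pascal's rule times \<open>k\<close>.\<close>

lemma choose_mult_diff:
  assumes "1 \<le> k" and "1 \<le> n"
  shows "real (n choose k) * real k - real ((n - 1) choose (k - 1)) * real k
    = real (k * ((n - 1) choose k))"
proof -
  have "n choose k = (n - 1 choose (k - 1)) + (n - 1 choose k)"
    using assms by (intro choose_reduce_nat) auto
  then show ?thesis by (simp add: algebra_simps)
qed

theorem theorem3:
  fixes n k :: nat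
  assumes "1 \<le> k" and "k \<le> n - 1"
  shows "\<exists>(q::nat) (M :: (nat \<Rightarrow> nat) measure) (S :: nat \<Rightarrow> nat set) (X :: nat \<Rightarrow> (nat \<Rightarrow> nat) \<Rightarrow> nat).
    q \<ge> 2 \<and> prob_space M \<and> prob_space.random_vector M n q S X \<and>
    prob_space.cohesion M (real q) n k X = real (k * ((n - 1) choose k))"
proof -
  obtain q where q: "prime q" "n < q" using bigger_prime by blast
  have q2: "2 \<le> q" using q(1) by (rule prime_ge_2_nat)
  define M where "M = uniform_count_measure (rs_messages q k)"
  define S where "S = (\<lambda>_::nat. {..<q})"
  define X where "X = rs_symbol q k"
  have ne: "rs_messages q k \<noteq> {}"
    using card_rs_messages[of q k] q2 by auto
  interpret prob_space M
    unfolding M_def using finite_rs_messages ne by (rule prob_space_uniform_count_measure)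
  have entropy: "joint_entropy (real q) X A = real k" if "A \<subseteq> {1..n}" "k \<le> card A" for A
    unfolding M_def X_def
    using joint_entropy_uniform_inj[OF finite_rs_messages ne _ inj_on_rs_symbols[OF q that]] q2
    by (simp add: card_rs_messages log_nat_power)
  have "random_vector n q S X"
    using q2 unfolding random_vector_def
    by (auto simp: S_def X_def M_def rs_symbol_def measurable_def space_uniform_count_measure
        sets_uniform_count_measure)
  moreover have "cohesion (real q) n k X = real (k * ((n - 1) choose k))"
  proof -
    \<comment> \<open>The entropy value \<open>k\<close> serves twice: for each \<open>A\<close> of
      size \<open>k\<close>, and for \<open>{1..n}\<close>, whose size is at least
      \<open>k\<close>.\<close>
    have "cohesion (real q) n k X =
        (\<Sum>A | A \<subseteq> {1..n} \<and> card A = k. real k) - real ((n - 1) choose (k - 1)) * real k"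
      unfolding cohesion_def using assms entropy by simp
    also have "\<dots> = real (n choose k) * real k - real ((n - 1) choose (k - 1)) * real k"
      by (simp add: n_subsets)
    also have "\<dots> = real (k * ((n - 1) choose k))"
      using assms by (intro choose_mult_diff) auto
    finally show ?thesis .
  qed
  ultimately show ?thesis
    using q2 prob_space_axioms by blast
qed

end
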